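(* Let $M$ be a cone over a smooth domain $C$ in the sphere $\mathbb{S}^n\subset\mathbb{R}^{n+1}$. Then either there exist isoperimetric regions in $M$ for any given value of volume $V>0$, or there are no isoperimetric regions in $M$ at all (for any volume).
   Context: A smooth domain $C\subset\mathbb{S}^n$ is a connected open set with smooth boundary; the cone over $C$ is $M=\{tp:t>0,\ p\in C\}\subset\mathbb{R}^{n+1}$. $\mathrm{vol}$ is $(n+1)$-dimensional Hausdorff measure. For measurable $\Omega\subseteq M$, $\mathcal{P}(\Omega)$ is the perimeter relative to $M$: $\mathcal{P}(\Omega)=\sup\{\int_\Omega\mathrm{div}\,Y\,d\mathcal{H}^{n+1}:|Y|\le1\}$ over smooth vector fields $Y$ with compact support in $M$. The isoperimetric profile is $I_M(V)=\inf\{\mathcal{P}(\Omega):\Omega\subseteq M,\ \mathrm{vol}(\Omega)=V\}$, $V>0$. An isoperimetric region of volume $V$ is a set $\Omega\subseteq M$ with $\mathrm{vol}(\Omega)=V$ and $\mathcal{P}(\Omega)=I_M(V)$. *)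

theory Defs
  imports "HOL-Analysis.Analysis"
begin

section \<open>Smooth maps and divergence\<close>

text \<open>The notions of this section are meant for open sets \<open>S\<close>: all derivatives are full
  Frechet derivatives in the ambient Euclidean space.  A map is \<open>k + 1\<close> times continuously
  differentiable iff it is differentiable and every directional derivative is \<open>k\<close> times
  continuously differentiable (in finite dimension).\<close>

primrec Ck_on :: "nat \<Rightarrow> ('a::euclidean_space \<Rightarrow> 'b::real_normed_vector) \<Rightarrow> 'a set \<Rightarrow> bool" where
  "Ck_on 0 f S \<longleftrightarrow> continuous_on S f"
| "Ck_on (Suc k) f S \<longleftrightarrow>
     (\<forall>x\<in>S. f differentiable (at x)) \<and> (\<forall>v. Ck_on k (\<lambda>x. frechet_derivative f (at x) v) S)"

definition smooth_on :: "('a::euclidean_space \<Rightarrow> 'b::real_normed_vector) \<Rightarrow> 'a set \<Rightarrow> bool" where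
  "smooth_on f S \<longleftrightarrow> (\<forall>k. Ck_on k f S)"

definition divergence :: "('a::euclidean_space \<Rightarrow> 'a) \<Rightarrow> 'a \<Rightarrow> real" where
  "divergence Y x = (\<Sum>b\<in>Basis. frechet_derivative Y (at x) b \<bullet> b)"

section \<open>Hausdorff measure\<close>

text \<open>The \<open>d\<close>-dimensional Hausdorff measure, normalised by the volume of the unit ball of
  dimension \<open>d\<close>.  Boundedness is demanded explicitly because \<^const>\<open>diameter\<close> is
  unspecified on unbounded sets; the empty set is singled out because of \<open>0 ^ 0 = 1\<close>
  (relevant for \<open>d = 0\<close> only).\<close>

definition hausdorff_weight :: "nat \<Rightarrow> 'a::metric_space set \<Rightarrow> ennreal" where
  "hausdorff_weight d U =
     (if U = {} then 0 else ennreal (unit_ball_vol (real d) * (diameter U / 2) ^ d))"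

definition hausdorff_covers :: "real \<Rightarrow> 'a::metric_space set \<Rightarrow> (nat \<Rightarrow> 'a set) set" where
  "hausdorff_covers \<delta> A =
     {U. A \<subseteq> (\<Union>i. U i) \<and> (\<forall>i. bounded (U i) \<and> diameter (U i) \<le> \<delta>)}"

definition hausdorff_premeasure :: "nat \<Rightarrow> real \<Rightarrow> 'a::metric_space set \<Rightarrow> ennreal" where
  "hausdorff_premeasure d \<delta> A = (INF U\<in>hausdorff_covers \<delta> A. \<Sum>i. hausdorff_weight d (U i))"

definition hausdorff_outer :: "nat \<Rightarrow> 'a::metric_space set \<Rightarrow> ennreal" where
  "hausdorff_outer d A = (SUP \<delta>\<in>{0<..}. hausdorff_premeasure d \<delta> A)"

text \<open>The measurable sets are those satisfying Caratheodory's condition.\<close>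

definition hausdorff_measure :: "nat \<Rightarrow> 'a::metric_space measure" where
  "hausdorff_measure d =
     measure_of UNIV (lambda_system UNIV (Pow UNIV) (hausdorff_outer d)) (hausdorff_outer d)"

text \<open>Since \<^const>\<open>measure_of\<close> returns the zero measure when its arguments do not form a
  measure space, we check that they do.\<close>

lemma hausdorff_premeasure_mono:
  "A \<subseteq> B \<Longrightarrow> hausdorff_premeasure d \<delta> A \<le> hausdorff_premeasure d \<delta> B"
  unfolding hausdorff_premeasure_def hausdorff_covers_def
  by (rule INF_superset_mono) auto

lemma hausdorff_premeasure_empty: "\<delta> > 0 \<Longrightarrow> hausdorff_premeasure d \<delta> {} = 0"
  unfolding hausdorff_premeasure_def hausdorff_covers_def
  by (intro antisym INF_lower2[of "\<lambda>_. {}"]) (auto simp: hausdorff_weight_def)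

lemma hausdorff_premeasure_UN:
  "hausdorff_premeasure d \<delta> (\<Union>i. A i) \<le> (\<Sum>i. hausdorff_premeasure d \<delta> (A i))"
proof (rule ennreal_le_epsilon)
  let ?H = "hausdorff_premeasure d \<delta>" and ?w = "hausdorff_weight d"
  fix e :: real
  assume e: "0 < e" and fin: "(\<Sum>i. ?H (A i)) < top"
  have less: "?H (A n) < ?H (A n) + e * (1/2) ^ Suc n" for n
    using fin e by (auto simp add: less_top dest!: ennreal_suminf_lessD)
  have "\<exists>U. U \<in> hausdorff_covers \<delta> (A n) \<and> (\<Sum>i. ?w (U i)) \<le> ?H (A n) + e * (1/2) ^ Suc n" for n
    using less[of n] unfolding hausdorff_premeasure_def INF_less_iff by (meson less_imp_le)
  then obtain B where B: "\<And>n. B n \<in> hausdorff_covers \<delta> (A n)"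
    and Ble: "\<And>n. (\<Sum>i. ?w (B n i)) \<le> ?H (A n) + e * (1/2) ^ Suc n"
    by metis
  define C where "C = case_prod B \<circ> prod_decode"
  have sub: "(\<Union>i. A i) \<subseteq> (\<Union>i. C i)"
  proof
    fix x assume "x \<in> (\<Union>i. A i)"
    then obtain n where "x \<in> A n" by auto
    then obtain i where "x \<in> B n i" using B[of n] by (auto simp: hausdorff_covers_def)
    then have "x \<in> C (prod_encode (n, i))" by (simp add: C_def)
    then show "x \<in> (\<Union>i. C i)" by blast
  qed
  have "C \<in> hausdorff_covers \<delta> (\<Union>i. A i)"
    using B sub by (auto simp: hausdorff_covers_def C_def split_def)
  then have "?H (\<Union>i. A i) \<le> (\<Sum>i. ?w (C i))"
    unfolding hausdorff_premeasure_def by (rule INF_lower)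
  also have "\<dots> = (\<Sum>n. \<Sum>i. ?w (B n i))"
    unfolding C_def comp_def by (intro suminf_ennreal_2dimen) auto
  also have "\<dots> \<le> (\<Sum>n. ?H (A n) + e * (1/2) ^ Suc n)"
    by (intro suminf_le allI Ble) auto
  also have "\<dots> = (\<Sum>n. ?H (A n)) + (\<Sum>n. ennreal e * ennreal ((1/2) ^ Suc n))"
    using e by (subst suminf_add[symmetric])
      (auto simp del: ennreal_suminf_cmult simp add: ennreal_mult[symmetric])
  also have "\<dots> = (\<Sum>n. ?H (A n)) + e"
    unfolding ennreal_suminf_cmult
    by (subst suminf_ennreal_eq[OF zero_le_power power_half_series]) auto
  finally show "?H (\<Union>i. A i) \<le> (\<Sum>n. ?H (A n)) + e" .
qed

lemma outer_measure_space_hausdorff: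
  "outer_measure_space (Pow UNIV) (hausdorff_outer d :: 'a::metric_space set \<Rightarrow> ennreal)"
  (is "outer_measure_space _ ?H")
  unfolding outer_measure_space_def
proof (intro conjI)
  show "positive (Pow UNIV) ?H"
    unfolding positive_def hausdorff_outer_def
    using SUP_cong[of "{0<..}" "{0<..}" "\<lambda>\<delta>. hausdorff_premeasure d \<delta> {}" "\<lambda>_. 0"]
    by (simp add: hausdorff_premeasure_empty)
  show "increasing (Pow UNIV) ?H"
    unfolding increasing_def hausdorff_outer_def
    by (auto intro!: SUP_mono' hausdorff_premeasure_mono)
  show "countably_subadditive (Pow UNIV) ?H"
    unfolding countably_subadditive_def
  proof (intro allI impI)
    fix A :: "nat \<Rightarrow> 'a set"
    show "hausdorff_outer d (\<Union>i. A i) \<le> (\<Sum>i. hausdorff_outer d (A i))"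
      unfolding hausdorff_outer_def[of d "\<Union>i. A i"]
    proof (rule SUP_least)
      fix \<delta> :: real assume "\<delta> \<in> {0<..}"
      then have "hausdorff_premeasure d \<delta> (A i) \<le> hausdorff_outer d (A i)" for i
        unfolding hausdorff_outer_def by (rule SUP_upper)
      then have "(\<Sum>i. hausdorff_premeasure d \<delta> (A i)) \<le> (\<Sum>i. hausdorff_outer d (A i))"
        by (intro suminf_le) auto
      then show "hausdorff_premeasure d \<delta> (\<Union>i. A i) \<le> (\<Sum>i. hausdorff_outer d (A i))"
        by (rule order_trans[OF hausdorff_premeasure_UN])
    qed
  qed
qed

lemma measure_space_hausdorff:
  "measure_space UNIV (lambda_system UNIV (Pow UNIV) (hausdorff_outer d)) (hausdorff_outer d)"
  by (rule sigma_algebra.caratheodory_lemma[OF sigma_algebra_Pow outer_measure_space_hausdorff])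

lemma space_hausdorff_measure: "space (hausdorff_measure d) = UNIV"
  unfolding hausdorff_measure_def by (simp add: space_measure_of_conv)

lemma sets_hausdorff_measure:
  "sets (hausdorff_measure d) = lambda_system UNIV (Pow UNIV) (hausdorff_outer d)"
  unfolding hausdorff_measure_def
  by (intro sigma_algebra.sets_measure_of_eq
    measure_space_hausdorff[unfolded measure_space_def, THEN conjunct1])

lemma emeasure_hausdorff_measure:
  assumes "A \<in> sets (hausdorff_measure d)"
  shows "emeasure (hausdorff_measure d) A = hausdorff_outer d A"
  using measure_space_hausdorff[of d] assms[unfolded sets_hausdorff_measure]
  unfolding hausdorff_measure_def measure_space_def
  by (intro emeasure_measure_of_sigma) blast+

section \<open>Cones over smooth domains of the sphere\<close>

text \<open>The ambient space is a Euclidean space \<open>'a\<close> of dimension \<open>DIM('a) = n + 1\<close>, with unit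
  sphere \<^term>\<open>sphere (0::'a::euclidean_space) 1\<close>.

  The boundary of \<open>C\<close> relative to the sphere is smooth if near each of its points \<open>C\<close> is
  the set of points of the sphere where a smooth function \<open>\<rho>\<close> is negative, the differential
  of \<open>\<rho>\<close> being nonzero on the tangent space \<open>{v. v \<bullet> p = 0}\<close> of the sphere.
  The boundary may be empty (\<open>C\<close> the whole sphere).\<close>

definition smooth_boundary_in_sphere :: "'a::euclidean_space set \<Rightarrow> bool" where
  "smooth_boundary_in_sphere C \<longleftrightarrow>
     (\<forall>p \<in> top_of_set (sphere 0 1) frontier_of C.
        \<exists>U (\<rho> :: 'a \<Rightarrow> real). open U \<and> p \<in> U \<and> smooth_on \<rho> U \<and>
          (\<exists>v. v \<bullet> p = 0 \<and> frechet_derivative \<rho> (at p) v \<noteq> 0) \<and>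
          C \<inter> U = {x \<in> sphere 0 1 \<inter> U. \<rho> x < 0})"

definition smooth_spherical_domain :: "'a::euclidean_space set \<Rightarrow> bool" where
  "smooth_spherical_domain C \<longleftrightarrow>
     openin (top_of_set (sphere 0 1)) C \<and> connected C \<and> smooth_boundary_in_sphere C"

text \<open>Unlike the library's \<^const>\<open>cone\<close>, this does not contain the vertex \<open>0\<close>
  and is an operation on sets.\<close>

definition cone_over :: "'a::real_vector set \<Rightarrow> 'a set" where
  "cone_over C = {t *\<^sub>R p | t p. t > 0 \<and> p \<in> C}"

section \<open>Perimeter and isoperimetric regions\<close>

abbreviation volume_measure :: "'a::euclidean_space measure" where
  "volume_measure \<equiv> hausdorff_measure DIM('a)"

definition test_fields :: "'a::euclidean_space set \<Rightarrow> ('a \<Rightarrow> 'a) set" where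
  "test_fields M =
     {Y. smooth_on Y UNIV \<and> compact (closure {x. Y x \<noteq> 0}) \<and> closure {x. Y x \<noteq> 0} \<subseteq> M \<and>
         (\<forall>x. norm (Y x) \<le> 1)}"

definition perimeter :: "'a::euclidean_space set \<Rightarrow> 'a set \<Rightarrow> ereal" where
  "perimeter M \<Omega> =
     (SUP Y\<in>test_fields M. ereal (set_lebesgue_integral volume_measure \<Omega> (divergence Y)))"

definition regions_of_volume :: "'a::euclidean_space set \<Rightarrow> real \<Rightarrow> 'a set set" where
  "regions_of_volume M V =
     {\<Omega>. \<Omega> \<subseteq> M \<and> \<Omega> \<in> sets volume_measure \<and> emeasure volume_measure \<Omega> = ennreal V}"

definition isoperimetric_profile :: "'a::euclidean_space set \<Rightarrow> real \<Rightarrow> ereal" where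
  "isoperimetric_profile M V = (INF \<Omega>\<in>regions_of_volume M V. perimeter M \<Omega>)"

definition isoperimetric_region :: "'a::euclidean_space set \<Rightarrow> real \<Rightarrow> 'a set \<Rightarrow> bool" where
  "isoperimetric_region M V \<Omega> \<longleftrightarrow>
     \<Omega> \<in> regions_of_volume M V \<and> perimeter M \<Omega> = isoperimetric_profile M V"

end

theory Submission
  imports Defs
begin

text \<open>With \<open>N = DIM('a)\<close>, the dilation \<open>x \<mapsto> s x\<close> preserves a cone \<open>M\<close>, multiplies
  volumes by \<open>s ^ N\<close> and relative perimeters by \<open>s ^ (N - 1)\<close>.  So it carries minimisers of
  volume \<open>V\<close> to minimisers of volume \<open>s ^ N * V\<close>, and the existence of a minimiser does not
  depend on the volume.\<close>

section \<open>Dilations and Hausdorff measure\<close>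

lemma scaleR_image_inverse:
  fixes A :: "'a::real_vector set"
  assumes "s \<noteq> 0"
  shows "(*\<^sub>R) (1 / s) ` (*\<^sub>R) s ` A = A" "(*\<^sub>R) s ` (*\<^sub>R) (1 / s) ` A = A"
  using assms by (simp_all add: image_image)

lemma vimage_scaleR_eq_image:
  fixes A :: "'a::real_vector set"
  assumes "s \<noteq> 0"
  shows "(*\<^sub>R) s -` A = (*\<^sub>R) (1 / s) ` A"
proof
  show "(*\<^sub>R) s -` A \<subseteq> (*\<^sub>R) (1 / s) ` A"
  proof
    fix x assume "x \<in> (*\<^sub>R) s -` A"
    then have "s *\<^sub>R x \<in> A" by simp
    then have "(1 / s) *\<^sub>R (s *\<^sub>R x) \<in> (*\<^sub>R) (1 / s) ` A" by (rule imageI)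
    then show "x \<in> (*\<^sub>R) (1 / s) ` A" using assms by simp
  qed
qed (use assms in auto)

lemma diameter_scaleR_image_le:
  fixes U :: "'a::real_normed_vector set"
  assumes "bounded U"
  shows "diameter ((*\<^sub>R) s ` U) \<le> \<bar>s\<bar> * diameter U"
proof (rule diameter_le)
  show "(*\<^sub>R) s ` U \<noteq> {} \<or> 0 \<le> \<bar>s\<bar> * diameter U"
    using diameter_ge_0[OF assms] by simp
  fix x y assume "x \<in> (*\<^sub>R) s ` U" "y \<in> (*\<^sub>R) s ` U"
  then obtain u v where uv: "u \<in> U" "v \<in> U" "x = s *\<^sub>R u" "y = s *\<^sub>R v" by auto
  then have "norm (x - y) = \<bar>s\<bar> * dist u v"
    by (simp add: dist_norm flip: scaleR_diff_right)
  also have "\<dots> \<le> \<bar>s\<bar> * diameter U"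
    using diameter_bounded_bound[OF assms uv(1,2)] by (intro mult_left_mono) auto
  finally show "norm (x - y) \<le> \<bar>s\<bar> * diameter U" .
qed

text \<open>The weight is homogeneous of degree \<open>d\<close> in the diameter. Inequalities are
  enough up to \<open>hausdorff_outer\<close>, where the dilation by \<open>1 / s\<close> supplies
  the reverse one.\<close>

lemma hausdorff_weight_scaleR_image_le:
  fixes U :: "'a::real_normed_vector set"
  assumes "bounded U" "s > 0"
  shows "hausdorff_weight d ((*\<^sub>R) s ` U) \<le> ennreal (s ^ d) * hausdorff_weight d U"
proof (cases "U = {}")
  case False
  have "0 \<le> diameter ((*\<^sub>R) s ` U)"
    using assms by (intro diameter_ge_0 bounded_scaling)
  then have "(diameter ((*\<^sub>R) s ` U) / 2) ^ d \<le> (s * (diameter U / 2)) ^ d"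
    using diameter_scaleR_image_le[of U s] assms by (intro power_mono) auto
  then have "unit_ball_vol (real d) * (diameter ((*\<^sub>R) s ` U) / 2) ^ d
      \<le> unit_ball_vol (real d) * (s * (diameter U / 2)) ^ d"
    by (intro mult_left_mono) auto
  also have "\<dots> = s ^ d * (unit_ball_vol (real d) * (diameter U / 2) ^ d)"
    by (simp only: power_mult_distrib mult_ac)
  finally have "ennreal (unit_ball_vol (real d) * (diameter ((*\<^sub>R) s ` U) / 2) ^ d)
      \<le> ennreal (s ^ d * (unit_ball_vol (real d) * (diameter U / 2) ^ d))"
    by (rule ennreal_leI)
  then show ?thesis
    using False assms diameter_ge_0[OF \<open>bounded U\<close>]
    by (simp add: hausdorff_weight_def ennreal_mult)
qed (simp add: hausdorff_weight_def)

text \<open>Dilating each set of a cover of \<open>A\<close> gives a cover of the dilated set; the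
  mesh bound is dilated as well, hence \<open>s * \<delta>\<close> on the left.\<close>

lemma hausdorff_premeasure_scaleR_image_le:
  fixes A :: "'a::real_normed_vector set"
  assumes "s > 0"
  shows "hausdorff_premeasure d (s * \<delta>) ((*\<^sub>R) s ` A) \<le> ennreal (s ^ d) * hausdorff_premeasure d \<delta> A"
proof -
  have le: "hausdorff_premeasure d (s * \<delta>) ((*\<^sub>R) s ` A)
      \<le> ennreal (s ^ d) * (\<Sum>i. hausdorff_weight d (U i))"
    if U: "U \<in> hausdorff_covers \<delta> A" for U
  proof -
    from U have bd: "bounded (U i)" "diameter (U i) \<le> \<delta>" for i
      by (auto simp: hausdorff_covers_def)
    have "diameter ((*\<^sub>R) s ` U i) \<le> s * \<delta>" for i
      using diameter_scaleR_image_le[OF bd(1), of s i] bd(2)[of i] assms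
      by (smt (verit) mult_left_mono)
    moreover have "(*\<^sub>R) s ` A \<subseteq> (\<Union>i. (*\<^sub>R) s ` U i)"
      using U unfolding hausdorff_covers_def image_UN[symmetric] by (intro image_mono) simp
    ultimately have "(\<lambda>i. (*\<^sub>R) s ` U i) \<in> hausdorff_covers (s * \<delta>) ((*\<^sub>R) s ` A)"
      using bd(1) by (simp add: hausdorff_covers_def bounded_scaling)
    then have "hausdorff_premeasure d (s * \<delta>) ((*\<^sub>R) s ` A)
        \<le> (\<Sum>i. hausdorff_weight d ((*\<^sub>R) s ` U i))"
      unfolding hausdorff_premeasure_def by (rule INF_lower)
    also have "\<dots> \<le> (\<Sum>i. ennreal (s ^ d) * hausdorff_weight d (U i))"
      using bd assms by (intro suminf_le hausdorff_weight_scaleR_image_le) auto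
    finally show ?thesis by simp
  qed
  have inv: "ennreal (1 / s ^ d) * ennreal (s ^ d) = 1" "ennreal (s ^ d) * ennreal (1 / s ^ d) = 1"
    using assms by (simp_all flip: ennreal_mult)
  \<comment> \<open>\<open>INF_greatest\<close> needs the infimum alone on the right, so the factor
    \<open>s ^ d\<close> is first moved to the left by its inverse and restored afterwards.\<close>
  have "ennreal (1 / s ^ d) * hausdorff_premeasure d (s * \<delta>) ((*\<^sub>R) s ` A)
      \<le> hausdorff_premeasure d \<delta> A"
    unfolding hausdorff_premeasure_def[of d \<delta> A]
  proof (rule INF_greatest)
    fix U assume "U \<in> hausdorff_covers \<delta> A"
    from mult_left_mono[OF le[OF this], of "ennreal (1 / s ^ d)"]
    show "ennreal (1 / s ^ d) * hausdorff_premeasure d (s * \<delta>) ((*\<^sub>R) s ` A)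
        \<le> (\<Sum>i. hausdorff_weight d (U i))"
      by (simp add: inv(1) flip: mult.assoc)
  qed
  from mult_left_mono[OF this, of "ennreal (s ^ d)"] show ?thesis
    by (simp add: inv(2) flip: mult.assoc)
qed

text \<open>The supremum over all mesh sizes absorbs the change of mesh: size \<delta> for the
  dilated set corresponds to size \<open>\<delta> / s\<close> for \<open>A\<close>.\<close>

lemma hausdorff_outer_scaleR_image_le:
  fixes A :: "'a::real_normed_vector set"
  assumes "s > 0"
  shows "hausdorff_outer d ((*\<^sub>R) s ` A) \<le> ennreal (s ^ d) * hausdorff_outer d A"
  unfolding hausdorff_outer_def[of d "(*\<^sub>R) s ` A"]
proof (rule SUP_least)
  fix \<delta> :: real assume "\<delta> \<in> {0<..}"
  then have "hausdorff_premeasure d (\<delta> / s) A \<le> hausdorff_outer d A"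
    unfolding hausdorff_outer_def using assms by (intro SUP_upper) auto
  then have "ennreal (s ^ d) * hausdorff_premeasure d (\<delta> / s) A
      \<le> ennreal (s ^ d) * hausdorff_outer d A"
    by (intro mult_left_mono) auto
  then show "hausdorff_premeasure d \<delta> ((*\<^sub>R) s ` A) \<le> ennreal (s ^ d) * hausdorff_outer d A"
    using hausdorff_premeasure_scaleR_image_le[OF assms, of d "\<delta> / s" A] assms by simp
qed

lemma hausdorff_outer_scaleR_image:
  fixes A :: "'a::real_normed_vector set"
  assumes "s > 0"
  shows "hausdorff_outer d ((*\<^sub>R) s ` A) = ennreal (s ^ d) * hausdorff_outer d A"
proof (rule antisym[OF hausdorff_outer_scaleR_image_le[OF assms]])
  \<comment> \<open>The reverse inequality is the previous lemma for the factor \<open>1 / s\<close>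
    and the dilated set.\<close>
  have "hausdorff_outer d A \<le> ennreal ((1 / s) ^ d) * hausdorff_outer d ((*\<^sub>R) s ` A)"
    using hausdorff_outer_scaleR_image_le[of "1 / s" d "(*\<^sub>R) s ` A"] assms
    by (simp add: scaleR_image_inverse)
  from mult_left_mono[OF this, of "ennreal (s ^ d)"]
  show "ennreal (s ^ d) * hausdorff_outer d A \<le> hausdorff_outer d ((*\<^sub>R) s ` A)"
    using assms by (simp add: power_one_over flip: mult.assoc ennreal_mult)
qed

text \<open>Caratheodory's condition quantifies over all test sets, and dilation permutes these
  while multiplying the outer measure by a constant.\<close>

lemma scaleR_image_in_sets_hausdorff:
  fixes A :: "'a::real_normed_vector set"
  assumes "s > 0" and A: "A \<in> sets (hausdorff_measure d)"
  shows "(*\<^sub>R) s ` A \<in> sets (hausdorff_measure d)"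
proof -
  have "hausdorff_outer d ((*\<^sub>R) s ` A \<inter> X) + hausdorff_outer d ((UNIV - (*\<^sub>R) s ` A) \<inter> X)
      = hausdorff_outer d X" for X
  proof -
    \<comment> \<open>Pulling the test set back by the inverse dilation makes the splitting of
      \<open>X\<close> the dilate of the splitting of \<open>Z\<close> by \<open>A\<close>.\<close>
    define Z where "Z = (*\<^sub>R) (1 / s) ` X"
    have X: "X = (*\<^sub>R) s ` Z"
      using assms by (simp add: Z_def scaleR_image_inverse)
    have inj: "inj ((*\<^sub>R) s :: 'a \<Rightarrow> 'a)"
      using assms by (auto intro: injI)
    have eqs: "(*\<^sub>R) s ` A \<inter> X = (*\<^sub>R) s ` (A \<inter> Z)"
      "(UNIV - (*\<^sub>R) s ` A) \<inter> X = (*\<^sub>R) s ` ((UNIV - A) \<inter> Z)"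
      unfolding X using inj by (simp_all add: image_Int image_set_diff flip: Compl_eq_Diff_UNIV)
        (auto dest: injD)
    have "hausdorff_outer d (A \<inter> Z) + hausdorff_outer d ((UNIV - A) \<inter> Z) = hausdorff_outer d Z"
      using A by (auto simp: sets_hausdorff_measure lambda_system_def)
    then show ?thesis
      using assms unfolding eqs unfolding X
      by (simp add: hausdorff_outer_scaleR_image flip: distrib_left)
  qed
  then show ?thesis by (auto simp: sets_hausdorff_measure lambda_system_def)
qed

lemma emeasure_hausdorff_scaleR_image:
  fixes A :: "'a::real_normed_vector set"
  assumes "s > 0" "A \<in> sets (hausdorff_measure d)"
  shows "emeasure (hausdorff_measure d) ((*\<^sub>R) s ` A)
    = ennreal (s ^ d) * emeasure (hausdorff_measure d) A"
  using assms
  by (simp add: emeasure_hausdorff_measure scaleR_image_in_sets_hausdorff hausdorff_outer_scaleR_image)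

lemma measurable_scaleR_hausdorff:
  fixes s :: real
  assumes "s > 0"
  shows "(*\<^sub>R) s \<in> measurable (hausdorff_measure d)
    (hausdorff_measure d :: 'a::real_normed_vector measure)"
proof (rule measurableI)
  fix A :: "'a set" assume "A \<in> sets (hausdorff_measure d)"
  then show "(*\<^sub>R) s -` A \<inter> space (hausdorff_measure d) \<in> sets (hausdorff_measure d)"
    using assms by (simp add: vimage_scaleR_eq_image space_hausdorff_measure scaleR_image_in_sets_hausdorff)
qed (simp add: space_hausdorff_measure)

text \<open>The pushforward evaluates preimages, which are dilates by \<open>1 / s\<close>; this is
  where the inverse factor comes from. It yields the change of variables for integrals.\<close>

lemma distr_scaleR_hausdorff:
  fixes s :: real
  assumes "s > 0"
  shows "distr (hausdorff_measure d) (hausdorff_measure d) ((*\<^sub>R) s)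
    = density (hausdorff_measure d :: 'a::real_normed_vector measure) (\<lambda>_. ennreal ((1 / s) ^ d))"
proof (rule measure_eqI)
  fix A :: "'a set"
  assume "A \<in> sets (distr (hausdorff_measure d) (hausdorff_measure d) ((*\<^sub>R) s))"
  then have A: "A \<in> sets (hausdorff_measure d)" by simp
  then show "emeasure (distr (hausdorff_measure d) (hausdorff_measure d) ((*\<^sub>R) s)) A
    = emeasure (density (hausdorff_measure d) (\<lambda>_. ennreal ((1 / s) ^ d))) A"
    using assms
    by (simp add: emeasure_distr measurable_scaleR_hausdorff space_hausdorff_measure
        vimage_scaleR_eq_image emeasure_hausdorff_scaleR_image emeasure_density_const
        del: power_one_over)
qed simp

text \<open>No measurability of \<open>f\<close> is assumed, so that the lemma applies to the integrals in
  \<^const>\<open>perimeter\<close> as they stand: both sides are the junk value \<open>0\<close> when \<open>f\<close> is not measurable.\<close>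

lemma integral_hausdorff_scaleR:
  fixes f :: "'a::real_normed_vector \<Rightarrow> real"
  assumes "s > 0"
  shows "(\<integral>x. f x \<partial>hausdorff_measure d) = s ^ d * (\<integral>x. f (s *\<^sub>R x) \<partial>hausdorff_measure d)"
proof (cases "f \<in> borel_measurable (hausdorff_measure d)")
  case True
  have "(\<integral>x. f (s *\<^sub>R x) \<partial>hausdorff_measure d)
      = (\<integral>x. f x \<partial>distr (hausdorff_measure d) (hausdorff_measure d) ((*\<^sub>R) s))"
    by (rule integral_distr[OF measurable_scaleR_hausdorff[OF assms] True, symmetric])
  also have "\<dots> = (1 / s) ^ d * (\<integral>x. f x \<partial>hausdorff_measure d)"
    unfolding distr_scaleR_hausdorff[OF assms]
    using True assms by (subst integral_density) auto
  finally show ?thesis using assms by (simp add: power_one_over)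
next
  case False
  have "(\<lambda>x. f (s *\<^sub>R x)) \<notin> borel_measurable (hausdorff_measure d)"
  proof
    assume "(\<lambda>x. f (s *\<^sub>R x)) \<in> borel_measurable (hausdorff_measure d)"
    \<comment> \<open>Composing with the inverse dilation recovers \<open>f\<close>, which would
      then be measurable.\<close>
    from measurable_compose[OF measurable_scaleR_hausdorff this, of "1 / s"]
    show False using False assms by simp
  qed
  with False have "\<not> integrable (hausdorff_measure d) f"
    "\<not> integrable (hausdorff_measure d) (\<lambda>x. f (s *\<^sub>R x))"
    using borel_measurable_integrable by blast+
  then show ?thesis by (simp add: not_integrable_integral_eq)
qed

section \<open>Dilations and test fields\<close>

text \<open>The outer factor \<open>a\<close> makes the induction close: by the chain rule, a
  directional derivative has the same form with \<open>a * c\<close> for \<open>a\<close> and a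
  directional derivative of \<open>f\<close> for \<open>f\<close>.\<close>

lemma Ck_on_UNIV_scaleR:
  assumes "Ck_on k f UNIV"
  shows "Ck_on k (\<lambda>x. a *\<^sub>R f (c *\<^sub>R x)) UNIV"
  using assms
proof (induction k arbitrary: f a)
  case 0
  then have "continuous_on UNIV f" by simp
  then show ?case
    by (auto intro!: continuous_intros continuous_on_compose2[of UNIV f])
next
  case (Suc k)
  have D: "((\<lambda>x. a *\<^sub>R f (c *\<^sub>R x)) has_derivative
      (\<lambda>v. (a * c) *\<^sub>R frechet_derivative f (at (c *\<^sub>R x)) v)) (at x)" for x
  proof -
    from Suc.prems have f: "(f has_derivative frechet_derivative f (at (c *\<^sub>R x))) (at (c *\<^sub>R x))"
      by (simp add: frechet_derivative_works)
    have "((\<lambda>x. a *\<^sub>R f (c *\<^sub>R x)) has_derivative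
        (\<lambda>v. a *\<^sub>R frechet_derivative f (at (c *\<^sub>R x)) (c *\<^sub>R v))) (at x)"
      by (intro derivative_intros has_derivative_compose[where g = f and f = "(*\<^sub>R) c"] f)
    then show ?thesis
      using linear_scale[OF has_derivative_linear[OF f]] by simp
  qed
  then have "frechet_derivative (\<lambda>x. a *\<^sub>R f (c *\<^sub>R x)) (at x)
      = (\<lambda>v. (a * c) *\<^sub>R frechet_derivative f (at (c *\<^sub>R x)) v)" for x
    by (metis frechet_derivative_at)
  moreover have "Ck_on k (\<lambda>x. (a * c) *\<^sub>R frechet_derivative f (at (c *\<^sub>R x)) v) UNIV" for v
    using Suc.prems by (intro Suc.IH) simp
  ultimately show ?case
    using D by (auto simp: differentiable_def)
qed

lemma smooth_on_UNIV_scaleR: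
  "smooth_on f UNIV \<Longrightarrow> smooth_on (\<lambda>x. f (c *\<^sub>R x)) UNIV"
  using Ck_on_UNIV_scaleR[of _ f 1 c] by (simp add: smooth_on_def)

lemma divergence_scaleR:
  assumes "Y differentiable (at (c *\<^sub>R x))"
  shows "divergence (\<lambda>x. Y (c *\<^sub>R x)) x = c * divergence Y (c *\<^sub>R x)"
proof -
  have Y: "(Y has_derivative frechet_derivative Y (at (c *\<^sub>R x))) (at (c *\<^sub>R x))"
    using assms by (simp add: frechet_derivative_works)
  have "((\<lambda>x. Y (c *\<^sub>R x)) has_derivative
      (\<lambda>v. frechet_derivative Y (at (c *\<^sub>R x)) (c *\<^sub>R v))) (at x)"
    by (intro derivative_intros has_derivative_compose[where g = Y and f = "(*\<^sub>R) c"] Y)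
  then have "frechet_derivative (\<lambda>x. Y (c *\<^sub>R x)) (at x)
      = (\<lambda>v. frechet_derivative Y (at (c *\<^sub>R x)) (c *\<^sub>R v))"
    by (metis frechet_derivative_at)
  then show ?thesis
    using linear_scale[OF has_derivative_linear[OF Y]]
    by (simp add: divergence_def sum_distrib_left)
qed

lemma scaleR_image_cone_over:
  assumes "s > 0"
  shows "(*\<^sub>R) s ` cone_over C \<subseteq> cone_over C"
proof
  fix y assume "y \<in> (*\<^sub>R) s ` cone_over C"
  then obtain t p where "y = (s * t) *\<^sub>R p" "t > 0" "p \<in> C" by (auto simp: cone_over_def)
  moreover have "s * t > 0" using assms \<open>t > 0\<close> by simp
  ultimately show "y \<in> cone_over C" unfolding cone_over_def by blast
qed

text \<open>The support of the new field is the dilate by \<open>s\<close> of the old one, so it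
  stays compact and inside \<open>M\<close>. Only the argument is rescaled, so the bound on the norm
  persists.\<close>

lemma test_fields_scaleR:
  fixes M :: "'a::euclidean_space set"
  assumes "s > 0" and M: "(*\<^sub>R) s ` M \<subseteq> M" and Y: "Y \<in> test_fields M"
  shows "(\<lambda>x. Y ((1 / s) *\<^sub>R x)) \<in> test_fields M"
proof -
  have "{x. Y ((1 / s) *\<^sub>R x) \<noteq> 0} = (*\<^sub>R) (1 / s) -` {x. Y x \<noteq> 0}" by auto
  also have "\<dots> = (*\<^sub>R) s ` {x. Y x \<noteq> 0}"
    using assms by (subst vimage_scaleR_eq_image) auto
  finally have "closure {x. Y ((1 / s) *\<^sub>R x) \<noteq> 0} = (*\<^sub>R) s ` closure {x. Y x \<noteq> 0}"
    by (simp add: closure_scaleR)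
  moreover have "smooth_on (\<lambda>x. Y ((1 / s) *\<^sub>R x)) UNIV"
    using Y by (intro smooth_on_UNIV_scaleR) (simp add: test_fields_def)
  moreover have "compact ((*\<^sub>R) s ` closure {x. Y x \<noteq> 0})"
    using Y by (intro compact_scaling) (simp add: test_fields_def)
  moreover have "(*\<^sub>R) s ` closure {x. Y x \<noteq> 0} \<subseteq> M"
    using Y M by (auto simp: test_fields_def)
  ultimately show ?thesis
    using Y by (simp add: test_fields_def del: compact_closure)
qed

section \<open>Scaling of the isoperimetric problem\<close>

text \<open>Each test field \<open>Y\<close> is transported to \<open>Y (x / s)\<close>. The change
  of variables contributes \<open>s ^ DIM('a)\<close> and the divergence contributes
  \<open>1 / s\<close>, which gives the exponent \<open>DIM('a) - 1\<close>.\<close>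

lemma perimeter_scaleR_image_ge:
  fixes M :: "'a::euclidean_space set"
  assumes s: "s > 0" and M: "(*\<^sub>R) s ` M \<subseteq> M"
  shows "ereal (s ^ (DIM('a) - 1)) * perimeter M \<Omega> \<le> perimeter M ((*\<^sub>R) s ` \<Omega>)"
proof -
  have le: "ereal (s ^ (DIM('a) - 1) * set_lebesgue_integral volume_measure \<Omega> (divergence Y))
      \<le> perimeter M ((*\<^sub>R) s ` \<Omega>)" if Y: "Y \<in> test_fields M" for Y
  proof -
    define Z where "Z = (\<lambda>x. Y ((1 / s) *\<^sub>R x))"
    have "\<forall>k. Ck_on k Y UNIV"
      using Y by (simp add: test_fields_def smooth_on_def)
    then have "Ck_on (Suc 0) Y UNIV" by blast
    then have "Y differentiable (at x)" for x by simp
    then have div: "divergence Z (s *\<^sub>R x) = (1 / s) * divergence Y x" for x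
      using divergence_scaleR[of Y "1 / s" "s *\<^sub>R x"] s by (simp add: Z_def)
    have ind: "indicator ((*\<^sub>R) s ` \<Omega>) (s *\<^sub>R x) = (indicator \<Omega> x :: real)" for x
      using s by (auto simp: indicator_def)
    have "set_lebesgue_integral volume_measure ((*\<^sub>R) s ` \<Omega>) (divergence Z)
        = s ^ DIM('a) * (\<integral>x. (1 / s) * (indicator \<Omega> x * divergence Y x) \<partial>volume_measure)"
      unfolding set_lebesgue_integral_def
      by (subst integral_hausdorff_scaleR[OF s]) (simp add: ind div mult.left_commute)
    also have "\<dots> = s ^ DIM('a) * (1 / s) * set_lebesgue_integral volume_measure \<Omega> (divergence Y)"
      unfolding set_lebesgue_integral_def integral_mult_right_zero by simp
    \<comment> \<open>The truncated subtraction is harmless because a Euclidean space has dimension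
      at least 1.\<close>
    also have "s ^ DIM('a) * (1 / s) = s ^ (DIM('a) - 1)"
      using s by (simp add: power_diff)
    finally have "s ^ (DIM('a) - 1) * set_lebesgue_integral volume_measure \<Omega> (divergence Y)
      = set_lebesgue_integral volume_measure ((*\<^sub>R) s ` \<Omega>) (divergence Z)" ..
    moreover have "Z \<in> test_fields M"
      unfolding Z_def by (rule test_fields_scaleR[OF s M Y])
    ultimately show ?thesis
      unfolding perimeter_def by (auto intro: SUP_upper2)
  qed
  define c where "c = s ^ (DIM('a) - 1)"
  have c: "c > 0" using s by (simp add: c_def)
  \<comment> \<open>The factor is moved to the other side so that \<open>SUP_least\<close> applies
    to the bare supremum. As \<open>c\<close> is positive and finite, this is sound even for
    infinite perimeters.\<close>
  have "perimeter M \<Omega> \<le> ereal (1 / c) * perimeter M ((*\<^sub>R) s ` \<Omega>)"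
    unfolding perimeter_def[of M \<Omega>]
  proof (rule SUP_least)
    fix Y assume "Y \<in> test_fields M"
    from ereal_mult_left_mono[OF le[OF this], of "ereal (1 / c)"]
    show "ereal (set_lebesgue_integral volume_measure \<Omega> (divergence Y))
        \<le> ereal (1 / c) * perimeter M ((*\<^sub>R) s ` \<Omega>)"
      using c unfolding c_def[symmetric] by simp
  qed
  then have "ereal c * perimeter M \<Omega> \<le> ereal c * (ereal (1 / c) * perimeter M ((*\<^sub>R) s ` \<Omega>))"
    using c by (intro ereal_mult_left_mono) auto
  also have "\<dots> = (ereal c * ereal (1 / c)) * perimeter M ((*\<^sub>R) s ` \<Omega>)"
    by (simp only: mult.assoc)
  also have "ereal c * ereal (1 / c) = 1" using c by simp
  finally show ?thesis by (simp add: c_def)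
qed

lemma perimeter_cone_scaleR_image:
  fixes C :: "'a::euclidean_space set"
  assumes s: "s > 0"
  shows "perimeter (cone_over C) ((*\<^sub>R) s ` \<Omega>)
    = ereal (s ^ (DIM('a) - 1)) * perimeter (cone_over C) \<Omega>"
proof (rule antisym)
  let ?P = "perimeter (cone_over C)"
  \<comment> \<open>A cone is invariant under \<open>1 / s\<close> too, so the one-sided bound for
    the inverse dilation gives the remaining inequality.\<close>
  have "ereal ((1 / s) ^ (DIM('a) - 1)) * ?P ((*\<^sub>R) s ` \<Omega>) \<le> ?P \<Omega>"
    using perimeter_scaleR_image_ge[of "1 / s" "cone_over C" "(*\<^sub>R) s ` \<Omega>"] s
      scaleR_image_cone_over[of "1 / s" C]
    by (simp add: scaleR_image_inverse)
  then have "ereal (s ^ (DIM('a) - 1)) * (ereal ((1 / s) ^ (DIM('a) - 1)) * ?P ((*\<^sub>R) s ` \<Omega>))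
      \<le> ereal (s ^ (DIM('a) - 1)) * ?P \<Omega>"
    using s by (intro ereal_mult_left_mono) auto
  moreover have "ereal (s ^ (DIM('a) - 1)) * ereal ((1 / s) ^ (DIM('a) - 1)) = 1"
    using s by (simp add: power_one_over)
  ultimately show "?P ((*\<^sub>R) s ` \<Omega>) \<le> ereal (s ^ (DIM('a) - 1)) * ?P \<Omega>"
    by (metis mult.assoc mult_1)
qed (rule perimeter_scaleR_image_ge[OF s scaleR_image_cone_over[OF s]])

lemma regions_of_volume_cone_scaleR_image:
  fixes C :: "'a::euclidean_space set"
  assumes "s > 0" and \<Omega>: "\<Omega> \<in> regions_of_volume (cone_over C) V"
  shows "(*\<^sub>R) s ` \<Omega> \<in> regions_of_volume (cone_over C) (s ^ DIM('a) * V)"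
  using assms scaleR_image_cone_over[OF \<open>s > 0\<close>, of C]
  by (auto simp: regions_of_volume_def scaleR_image_in_sets_hausdorff
      emeasure_hausdorff_scaleR_image ennreal_mult')

lemma isoperimetric_region_cone_scaleR_image:
  fixes C :: "'a::euclidean_space set"
  assumes s: "s > 0" and \<Omega>: "isoperimetric_region (cone_over C) V \<Omega>"
  shows "isoperimetric_region (cone_over C) (s ^ DIM('a) * V) ((*\<^sub>R) s ` \<Omega>)"
proof -
  let ?M = "cone_over C" and ?W = "s ^ DIM('a) * V"
  have reg: "(*\<^sub>R) s ` \<Omega> \<in> regions_of_volume ?M ?W"
    using s \<Omega> by (simp add: isoperimetric_region_def regions_of_volume_cone_scaleR_image)
  have "perimeter ?M ((*\<^sub>R) s ` \<Omega>) \<le> perimeter ?M \<Omega>'" if \<Omega>': "\<Omega>' \<in> regions_of_volume ?M ?W" for \<Omega>'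
  proof -
    \<comment> \<open>A competitor for the new volume is shrunk to one of volume \<open>V\<close>,
      compared there with the minimiser \<Omega>, and dilated back.\<close>
    have "(*\<^sub>R) (1 / s) ` \<Omega>' \<in> regions_of_volume ?M ((1 / s) ^ DIM('a) * ?W)"
      using s \<Omega>' by (intro regions_of_volume_cone_scaleR_image) auto
    then have "(*\<^sub>R) (1 / s) ` \<Omega>' \<in> regions_of_volume ?M V"
      using s by (simp add: power_one_over)
    then have "perimeter ?M \<Omega> \<le> perimeter ?M ((*\<^sub>R) (1 / s) ` \<Omega>')"
      using \<Omega> by (auto simp: isoperimetric_region_def isoperimetric_profile_def intro: INF_lower)
    then have "perimeter ?M ((*\<^sub>R) s ` \<Omega>) \<le> perimeter ?M ((*\<^sub>R) s ` (*\<^sub>R) (1 / s) ` \<Omega>')"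
      using s unfolding perimeter_cone_scaleR_image[OF s] by (intro ereal_mult_left_mono) auto
    then show ?thesis using s by (simp add: scaleR_image_inverse)
  qed
  then have "perimeter ?M ((*\<^sub>R) s ` \<Omega>) = isoperimetric_profile ?M ?W"
    unfolding isoperimetric_profile_def
    using reg by (intro antisym INF_greatest INF_lower)
  with reg show ?thesis by (simp add: isoperimetric_region_def)
qed

theorem proposition3p2:
  fixes C M :: "'a::euclidean_space set"
  assumes "smooth_spherical_domain C"
    and "M = cone_over C"
  shows "(\<forall>V>0. \<exists>\<Omega>. isoperimetric_region M V \<Omega>) \<or>
         (\<forall>V>0. \<not> (\<exists>\<Omega>. isoperimetric_region M V \<Omega>))"
proof -
  \<comment> \<open>A minimiser for one positive volume gives one for every positive volume, which
    is the dichotomy.\<close>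
  have "\<exists>\<Omega>. isoperimetric_region M W \<Omega>" if "V > 0" "W > 0" "isoperimetric_region M V \<Omega>" for V W \<Omega>
  proof -
    \<comment> \<open>Volumes scale by \<open>s ^ DIM('a)\<close>, so this is the factor that takes
      \<open>V\<close> to \<open>W\<close>.\<close>
    define s where "s = root DIM('a) (W / V)"
    have "s > 0" "s ^ DIM('a) * V = W"
      using that by (simp_all add: s_def)
    with isoperimetric_region_cone_scaleR_image[of s C V \<Omega>] that assms(2) show ?thesis by auto
  qed
  then show ?thesis by blast
qed

end
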